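(* Let $E$ be a strongly truncated Riesz space with no nonzero $^{\ast}$-infinitely small elements. Then the map $T:E\rightarrow C_{0}(\eta E)$ defined by \[ T(f)(u)=u(f)\quad\text{for all }f\in E\text{ and }u\in\eta E \] is (well defined and) an injective $^{\ast}$-homomorphism whose range is uniformly dense in $C_{0}(\eta E)$.
   Context: A Riesz space is a real vector lattice, with positive cone $E^{+}$. A truncation on a Riesz space $E$ is a unary operation $\ast:E^{+}\to E^{+}$, $f\mapsto f^{\ast}$, such that $f^{\ast}\wedge g=f\wedge g^{\ast}$ for all $f,g\in E^{+}$; a Riesz space with a truncation is called a truncated Riesz space. Put $P_{\ast}(E)=\{f\in E^{+}:f^{\ast}=f\}$. The truncation is strong if for each $f\in E^{+}$ there is $\varepsilon\in(0,\infty)$ with $\varepsilon f\in P_{\ast}(E)$; a Riesz space with a strong truncation is called a strongly truncated Riesz space. An element $f\in E$ is $^{\ast}$-infinitely small if $\varepsilon|f|\in P_{\ast}(E)$ for all $\varepsilon\in(0,\infty)$. A $^{\ast}$-homomorphism between truncated Riesz spaces $E,F$ is a Riesz homomorphism (linear lattice homomorphism) $T:E\to F$ with $T(f^{\ast})=T(f)^{\ast}$ for all $f\in E^{+}$. The space $\mathbb{R}$ carries the canonical truncation $r^{\ast}=\min\{1,r\}$ for $r\ge 0$. The spectrum $\eta E$ is the set of all nonzero $^{\ast}$-homomorphisms $u:E\to\mathbb{R}$, with the topology inherited from the product topology on $\mathbb{R}^{E}$; for a strongly truncated $E$ it is a locally compact Hausdorff space. For a locally compact Hausdorff space $X$, $C_{0}(X)$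 is the Riesz space of continuous $f:X\to\mathbb{R}$ such that $\{x\in X:|f(x)|\ge\varepsilon\}$ is compact for every $\varepsilon>0$, equipped with the uniform norm and the truncation $f^{\ast}=1\wedge f$ (pointwise minimum with the constant function $1$) for $f\ge 0$. "Uniformly dense" means dense for the uniform norm. *)

theory Defs
  imports
    "HOL-Analysis.Analysis"
    "HOL-Library.Lattice_Algebras"
    "HOL-Library.Function_Algebras"
begin

section \<open>Riesz spaces\<close>

class riesz_space = ordered_real_vector + lattice_ab_group_add

instance real :: riesz_space ..

text \<open>The space of all functions into a Riesz space, with the pointwise operations and
  order; \<open>C0 X\<close> below is a Riesz subspace of it.\<close>

instantiation "fun" :: (type, real_vector) real_vector
begin

definition scaleR_fun :: "real \<Rightarrow> ('a \<Rightarrow> 'b) \<Rightarrow> 'a \<Rightarrow> 'b"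
  where "scaleR_fun r f = (\<lambda>x. r *\<^sub>R f x)"

instance
  by standard (simp_all add: scaleR_fun_def fun_eq_iff plus_fun_def algebra_simps)

end

instance "fun" :: (type, riesz_space) riesz_space
  by standard (auto simp: scaleR_fun_def le_fun_def scaleR_left_mono scaleR_right_mono)

abbreviation riesz_abs :: "'a::riesz_space \<Rightarrow> 'a"
  where "riesz_abs f \<equiv> sup f (- f)"

definition riesz_hom :: "('a::riesz_space \<Rightarrow> 'b::riesz_space) \<Rightarrow> bool"
  where "riesz_hom T \<longleftrightarrow>
    linear T \<and> (\<forall>f g. T (sup f g) = sup (T f) (T g)) \<and> (\<forall>f g. T (inf f g) = inf (T f) (T g))"


section \<open>Truncations\<close>

text \<open>A truncation is an operation on the positive cone. It is rendered by a total function of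
  which only the values at elements \<open>f \<ge> 0\<close> are ever used.\<close>

definition truncation :: "('a::riesz_space \<Rightarrow> 'a) \<Rightarrow> bool"
  where "truncation t \<longleftrightarrow>
    (\<forall>f\<ge>0. 0 \<le> t f) \<and> (\<forall>f\<ge>0. \<forall>g\<ge>0. inf (t f) g = inf f (t g))"

definition trunc_fixed :: "('a::riesz_space \<Rightarrow> 'a) \<Rightarrow> 'a set"
  where "trunc_fixed t = {f. 0 \<le> f \<and> t f = f}"

definition strong_truncation :: "('a::riesz_space \<Rightarrow> 'a) \<Rightarrow> bool"
  where "strong_truncation t \<longleftrightarrow>
    truncation t \<and> (\<forall>f\<ge>0. \<exists>\<epsilon>>0. \<epsilon> *\<^sub>R f \<in> trunc_fixed t)"

definition infinitely_small :: "('a::riesz_space \<Rightarrow> 'a) \<Rightarrow> 'a \<Rightarrow> bool"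
  where "infinitely_small t f \<longleftrightarrow> (\<forall>\<epsilon>>0. \<epsilon> *\<^sub>R riesz_abs f \<in> trunc_fixed t)"

text \<open>If \<open>F\<close> is a Riesz subspace of \<open>'b\<close> that is closed under the truncation \<open>s\<close>, then \<open>T\<close> is a
  homomorphism of truncated Riesz spaces into \<open>F\<close> iff \<open>star_hom t s T\<close> and \<open>range T \<subseteq> F\<close>.\<close>

definition star_hom ::
    "('a::riesz_space \<Rightarrow> 'a) \<Rightarrow> ('b::riesz_space \<Rightarrow> 'b) \<Rightarrow> ('a \<Rightarrow> 'b) \<Rightarrow> bool"
  where "star_hom t s T \<longleftrightarrow> riesz_hom T \<and> (\<forall>f\<ge>0. T (t f) = s (T f))"

lemma truncation_real: "truncation (min (1::real))"
  by (auto simp: truncation_def inf_min min_def)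

lemma truncation_fun: "truncation (inf (1 :: 'b \<Rightarrow> real))"
  by (auto simp: truncation_def le_fun_def fun_eq_iff inf_min min_def)


section \<open>The spectrum\<close>

definition spectrum :: "('a::riesz_space \<Rightarrow> 'a) \<Rightarrow> ('a \<Rightarrow> real) set"
  where "spectrum t = {u. star_hom t (min 1) u \<and> u \<noteq> (\<lambda>f. 0)}"

definition spectrum_topology :: "('a::riesz_space \<Rightarrow> 'a) \<Rightarrow> ('a \<Rightarrow> real) topology"
  where "spectrum_topology t = subtopology (powertop_real UNIV) (spectrum t)"

lemma topspace_spectrum_topology [simp]: "topspace (spectrum_topology t) = spectrum t"
  by (simp add: spectrum_topology_def)


section \<open>Continuous functions vanishing at infinity\<close>

text \<open>A real function on the points of \<open>X\<close> is represented by its extension by \<open>0\<close> to the whole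
  type. Thus distinct elements of \<open>C0 X\<close> differ at a point of \<open>X\<close>, and the pointwise operations
  (including \<open>f \<mapsto> 1 \<and> f\<close>, written \<open>inf 1\<close>) restrict to \<open>C0 X\<close>.\<close>

definition C0 :: "'b topology \<Rightarrow> ('b \<Rightarrow> real) set"
  where "C0 X = {f. continuous_map X euclideanreal f \<and>
    (\<forall>\<epsilon>>0. compactin X {x \<in> topspace X. \<epsilon> \<le> \<bar>f x\<bar>}) \<and>
    (\<forall>x. x \<notin> topspace X \<longrightarrow> f x = 0)}"

text \<open>For functions that vanish off \<open>X\<close> the supremum over the whole type is the supremum over
  \<open>X\<close>, and it is \<open>0\<close>, as it should be, if \<open>X\<close> is empty (the spectrum of the zero space).\<close>

definition uniform_norm :: "('b \<Rightarrow> real) \<Rightarrow> real"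
  where "uniform_norm f = (SUP x. \<bar>f x\<bar>)"

definition uniformly_dense :: "('b \<Rightarrow> real) set \<Rightarrow> ('b \<Rightarrow> real) set \<Rightarrow> bool"
  where "uniformly_dense S F \<longleftrightarrow>
    S \<subseteq> F \<and> (\<forall>h\<in>F. \<forall>\<epsilon>>0. \<exists>g\<in>S. uniform_norm (h - g) < \<epsilon>)"

lemma C0_compactinI:
  assumes "continuous_map X euclideanreal h"
    and "compactin X K" and "{x \<in> topspace X. \<epsilon> \<le> \<bar>h x\<bar>} \<subseteq> K"
  shows "compactin X {x \<in> topspace X. \<epsilon> \<le> \<bar>h x\<bar>}"
proof -
  have "continuous_map X euclideanreal (\<lambda>x. \<bar>h x\<bar>)"
    using assms(1) by (rule continuous_map_real_abs)
  then have "closedin X {x \<in> topspace X. \<bar>h x\<bar> \<in> {\<epsilon>..}}"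
    by (rule closedin_continuous_map_preimage) auto
  then show ?thesis
    using closed_compactin[OF assms(2,3)] by simp
qed

lemma C0_compactin:
  "f \<in> C0 X \<Longrightarrow> \<epsilon> > 0 \<Longrightarrow> compactin X {x \<in> topspace X. \<epsilon> \<le> \<bar>f x\<bar>}"
  by (simp add: C0_def)

lemma C0_zero: "0 \<in> C0 X"
  by (auto simp: C0_def zero_fun_def)

lemma C0_add:
  assumes "f \<in> C0 X" "g \<in> C0 X"
  shows "f + g \<in> C0 X"
proof -
  have c: "continuous_map X euclideanreal (f + g)"
    using assms by (auto simp: C0_def plus_fun_def intro!: continuous_intros)
  moreover have "compactin X {x \<in> topspace X. \<epsilon> \<le> \<bar>(f + g) x\<bar>}" if "\<epsilon> > 0" for \<epsilon>
    by (rule C0_compactinI[OF c, where K =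
          "{x \<in> topspace X. \<epsilon>/2 \<le> \<bar>f x\<bar>} \<union> {x \<in> topspace X. \<epsilon>/2 \<le> \<bar>g x\<bar>}"])
      (use C0_compactin[OF assms(1), of "\<epsilon>/2"] C0_compactin[OF assms(2), of "\<epsilon>/2"] that
        in \<open>auto simp del: le_divide_eq_numeral1 intro!: compactin_Un\<close>)
  ultimately show ?thesis
    using assms by (auto simp: C0_def)
qed

lemma C0_scaleR:
  assumes "f \<in> C0 X"
  shows "r *\<^sub>R f \<in> C0 X"
proof (cases "r = 0")
  case True
  then show ?thesis by (simp add: C0_zero)
next
  case False
  have c: "continuous_map X euclideanreal (r *\<^sub>R f)"
    using assms by (auto simp: C0_def scaleR_fun_def intro!: continuous_intros)
  moreover have "compactin X {x \<in> topspace X. \<epsilon> \<le> \<bar>(r *\<^sub>R f) x\<bar>}" if "\<epsilon> > 0" for \<epsilon>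
    by (rule C0_compactinI[OF c, where K = "{x \<in> topspace X. \<epsilon>/\<bar>r\<bar> \<le> \<bar>f x\<bar>}"])
      (use C0_compactin[OF assms, of "\<epsilon>/\<bar>r\<bar>"] that False
        in \<open>simp_all add: scaleR_fun_def abs_mult pos_divide_le_eq subset_eq mult.commute\<close>)
  ultimately show ?thesis
    using assms by (auto simp: C0_def scaleR_fun_def)
qed

lemma C0_sup:
  assumes "f \<in> C0 X" "g \<in> C0 X"
  shows "sup f g \<in> C0 X"
proof -
  have c: "continuous_map X euclideanreal (sup f g)"
    using assms by (auto simp: C0_def sup_fun_def sup_max intro!: continuous_map_real_max)
  moreover have "compactin X {x \<in> topspace X. \<epsilon> \<le> \<bar>(sup f g) x\<bar>}" if "\<epsilon> > 0" for \<epsilon>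
    by (rule C0_compactinI[OF c, where K =
          "{x \<in> topspace X. \<epsilon> \<le> \<bar>f x\<bar>} \<union> {x \<in> topspace X. \<epsilon> \<le> \<bar>g x\<bar>}"])
      (use assms that in \<open>auto simp: C0_def sup_max max_def intro!: compactin_Un split: if_splits\<close>)
  ultimately show ?thesis
    using assms by (auto simp: C0_def)
qed

lemma C0_inf:
  assumes "f \<in> C0 X" "g \<in> C0 X"
  shows "inf f g \<in> C0 X"
proof -
  have "inf f g = (-1) *\<^sub>R sup ((-1) *\<^sub>R f) ((-1) *\<^sub>R g)"
    by (auto simp: fun_eq_iff scaleR_fun_def inf_min sup_max)
  then show ?thesis
    using assms by (simp only: C0_scaleR C0_sup)
qed

lemma C0_truncation:
  assumes "f \<in> C0 X" "0 \<le> f"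
  shows "inf 1 f \<in> C0 X"
proof -
  have c: "continuous_map X euclideanreal (inf 1 f)"
    using assms by (auto simp: C0_def inf_fun_def inf_min one_fun_def intro!: continuous_map_real_min)
  moreover have "compactin X {x \<in> topspace X. \<epsilon> \<le> \<bar>(inf 1 f) x\<bar>}" if "\<epsilon> > 0" for \<epsilon>
    by (rule C0_compactinI[OF c, where K = "{x \<in> topspace X. \<epsilon> \<le> \<bar>f x\<bar>}"])
      (use assms that in \<open>auto simp: C0_def le_fun_def inf_min min_def split: if_splits\<close>)
  ultimately show ?thesis
    using assms by (auto simp: C0_def inf_min)
qed

definition spectrum_eval :: "('a::riesz_space \<Rightarrow> 'a) \<Rightarrow> 'a \<Rightarrow> ('a \<Rightarrow> real) \<Rightarrow> real"
  where "spectrum_eval t f = (\<lambda>u. if u \<in> spectrum t then u f else 0)"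

end

theory Submission
  imports Defs
begin

text \<open>Two things have to be supplied: enough \<open>*\<close>-homomorphisms into the reals, and an approximation
  theorem on the locally compact space that they form.

  For the first, let \<open>P\<close> be the set of fixed points of the truncation. It is solid in the positive
  cone and closed under finite suprema, and strength says that its positive multiples dominate
  every element, so its gauge \<open>p\<close> is a finite sublinear functional with
  \<open>p (a \<squnion> b) = max (p a) (p b)\<close>. An element \<open>f \<ge> 0\<close> with \<open>p f = 0\<close> is infinitely small, so \<open>p\<close> is
  strictly positive on nonzero positive elements. Functionals like \<open>p\<close> behave as
  \<open>a \<mapsto> sup (w \<cdot> a)\<close> for a weight \<open>w\<close> on some space of points, and Riesz homomorphisms are the ones
  where the supremum is over a single point. Accordingly, a minimal sublinear functional among
  those that turn suprema into maxima is linear (\<open>minimal_max_sublinear_riesz_hom\<close>), and Zorn's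
  lemma puts one below \<open>p\<close>. Starting from a variant of \<open>p\<close> that remembers only the points where
  \<open>f\<close> attains \<open>p f\<close>, this gives a Riesz homomorphism \<open>u \<le> p\<close> with \<open>u f = p f\<close>
  (\<open>riesz_hom_attaining\<close>). Since \<open>u \<le> p\<close> and \<open>u f = p f > 0\<close>, the supremum of \<open>u\<close> on \<open>P\<close> is exactly
  \<open>1\<close>, and this is what makes \<open>u\<close> commute with the truncations. Injectivity follows.

  For the second, the set of all \<open>*\<close>-homomorphisms into the reals, the zero functional included, is
  compact: it is closed in a product of bounded intervals. The zero functional is therefore a
  point at infinity for the spectrum; this shows that evaluations vanish at infinity, and that
  every function vanishing at infinity on the spectrum, extended by \<open>0\<close>, is continuous on a
  compact space. The lattice form of the Stone-Weierstrass theorem applies there once a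
  function with value \<open>0\<close> at the zero functional can be interpolated at any two points by the
  evaluation of one element. This is possible because distinct points of the spectrum are linearly
  independent: proportional ones agree on \<open>t (n f)\<close> for large \<open>n\<close>, where both are \<open>1\<close>.\<close>

section \<open>Sublinear functionals that turn suprema into maxima\<close>

lemma le_scaleR_trans:
  fixes a g k :: "'a::ordered_real_vector"
  assumes "a \<le> r *\<^sub>R g" "0 \<le> r" "g \<le> k"
  shows "a \<le> r *\<^sub>R k"
  using assms(1) scaleR_left_mono[OF assms(3,2)] by (rule order_trans)

lemma riesz_homI:
  fixes u :: "'a::riesz_space \<Rightarrow> real"
  assumes "linear u" "\<And>a b. u (sup a b) = max (u a) (u b)"
  shows "riesz_hom u"
  unfolding riesz_hom_def
proof (intro conjI allI)
  fix f g
  show "u (sup f g) = sup (u f) (u g)"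
    by (simp add: assms(2) sup_max)
  show "u (inf f g) = inf (u f) (u g)"
    unfolding inf_eq_neg_sup[of f g] linear_neg[OF assms(1)] assms(2)
    by (simp add: inf_min min_def max_def)
qed (fact assms(1))

text \<open>The model is \<open>a \<mapsto> sup (w \<cdot> a)\<close> with a nonnegative weight \<open>w\<close> on a
  space of points on which the elements are functions. Monotonicity is the case \<open>a \<le> b\<close> of the
  last clause.\<close>

definition max_sublinear :: "('a::riesz_space \<Rightarrow> real) \<Rightarrow> bool"
  where "max_sublinear q \<longleftrightarrow>
    (\<forall>a b. q (a + b) \<le> q a + q b) \<and> (\<forall>r>0. \<forall>a. q (r *\<^sub>R a) = r * q a) \<and>
    (\<forall>a b. q (sup a b) = max (q a) (q b))"

lemma max_sublinearD:
  assumes "max_sublinear q"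
  shows "q (a + b) \<le> q a + q b" "r > 0 \<Longrightarrow> q (r *\<^sub>R a) = r * q a"
    "q (sup a b) = max (q a) (q b)"
  using assms by (auto simp: max_sublinear_def)

lemma max_sublinear_zero:
  assumes "max_sublinear q"
  shows "q 0 = 0"
  using max_sublinearD(2)[OF assms, of 2 0] by simp

lemma max_sublinear_scaleR:
  assumes "max_sublinear q" "0 \<le> r"
  shows "q (r *\<^sub>R a) = r * q a"
  using max_sublinearD(2)[OF assms(1), of r a] max_sublinear_zero[OF assms(1)] assms(2)
  by (cases "r = 0") auto

lemma max_sublinear_neg:
  assumes "max_sublinear q"
  shows "- q (- a) \<le> q a"
  using max_sublinearD(1)[OF assms, of a "- a"] max_sublinear_zero[OF assms] by simp

text \<open>Maxima commute with infima along downward directed families, since two indices that nearly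
  attain two infima can be replaced by a common smaller one. Subadditivity and homogeneity are only
  asked of the infimum against each member: this covers chains of functionals as well as
  \<open>peak\<close> below, whose individual members are not subadditive.\<close>

lemma max_sublinear_INF_directed:
  fixes q :: "'i \<Rightarrow> 'a::riesz_space \<Rightarrow> real"
  assumes ne: "I \<noteq> {}"
    and sub: "\<And>i a b. i \<in> I \<Longrightarrow> (INF j\<in>I. q j (a + b)) \<le> q i a + q i b"
    and mx: "\<And>i a b. i \<in> I \<Longrightarrow> q i (sup a b) = max (q i a) (q i b)"
    and bd: "\<And>a. bdd_below ((\<lambda>i. q i a) ` I)"
    and dir: "\<And>i j. i \<in> I \<Longrightarrow> j \<in> I \<Longrightarrow> \<exists>k\<in>I. q k \<le> q i \<and> q k \<le> q j"
    and hom: "\<And>i r a. i \<in> I \<Longrightarrow> r > 0 \<Longrightarrow> (INF j\<in>I. q j (r *\<^sub>R a)) \<le> r * q i a"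
  shows "max_sublinear (\<lambda>a. INF i\<in>I. q i a)"
proof -
  let ?q = "\<lambda>a. INF i\<in>I. q i a"
  have low: "?q a \<le> q i a" if "i \<in> I" for i a
    using bd that by (rule cINF_lower)
  have below: "\<exists>k\<in>I. q k a < x \<and> q k b < y" if less: "?q a < x" "?q b < y" for a b x y
  proof -
    obtain i where i: "i \<in> I" "q i a < x"
      using iffD1[OF cINF_less_iff[OF ne bd] less(1)] by blast
    obtain j where j: "j \<in> I" "q j b < y"
      using iffD1[OF cINF_less_iff[OF ne bd] less(2)] by blast
    obtain k where "k \<in> I" "q k \<le> q i" "q k \<le> q j"
      using dir[OF i(1) j(1)] by blast
    with i j show ?thesis
      by (auto simp: le_fun_def intro!: bexI[of _ k] intro: le_less_trans)
  qed
  have "?q (a + b) \<le> ?q a + ?q b" for a b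
  proof (rule field_le_epsilon)
    fix e :: real assume "e > 0"
    then obtain k where "k \<in> I" "q k a < ?q a + e/2" "q k b < ?q b + e/2"
      using below[of a "?q a + e/2" b "?q b + e/2"] by auto
    then show "?q (a + b) \<le> ?q a + ?q b + e"
      using sub[of k a b] by simp
  qed
  moreover have "?q (sup a b) = max (?q a) (?q b)" for a b
  proof (rule antisym)
    show "?q (sup a b) \<le> max (?q a) (?q b)"
    proof (rule field_le_epsilon)
      fix e :: real assume "e > 0"
      then obtain k where "k \<in> I" "q k a < ?q a + e" "q k b < ?q b + e"
        using below[of a "?q a + e" b "?q b + e"] by auto
      then show "?q (sup a b) \<le> max (?q a) (?q b) + e"
        using low[of k "sup a b"] mx[of k a b] by (auto simp: max_def split: if_splits)
    qed
    show "max (?q a) (?q b) \<le> ?q (sup a b)"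
      by (intro max.boundedI cINF_mono[OF ne bd]) (use mx in force)+
  qed
  moreover have "?q (r *\<^sub>R a) = r * ?q a" if "r > 0" for r a
  proof -
    have le: "?q (r *\<^sub>R a) \<le> r * ?q a" if "r > 0" for r a
    proof -
      have "?q (r *\<^sub>R a) / r \<le> ?q a"
        using hom that by (intro cINF_greatest ne) (simp add: pos_divide_le_eq mult.commute)
      then show ?thesis
        using that by (simp add: pos_divide_le_eq mult.commute)
    qed
    show ?thesis
      using le[OF that, of a] le[of "1/r" "r *\<^sub>R a"] that by (simp add: field_simps)
  qed
  ultimately show ?thesis
    by (simp add: max_sublinear_def)
qed

text \<open>The terms decrease with \<open>s\<close>. In the model \<open>q a = sup (w \<cdot> a)\<close> over a compact space, adding a large
  multiple of \<open>g\<close> forces the supremum onto the points where \<open>w \<cdot> g\<close> is maximal, so the limit is the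
  supremum of \<open>w \<cdot> a\<close> over these points.\<close>

definition peak :: "('a::riesz_space \<Rightarrow> real) \<Rightarrow> 'a \<Rightarrow> 'a \<Rightarrow> real"
  where "peak q g a = (INF s\<in>{0..}. q (a + s *\<^sub>R g) - s * q g)"

lemma peak_bdd_below:
  assumes "max_sublinear q"
  shows "bdd_below ((\<lambda>s. q (a + s *\<^sub>R g) - s * q g) ` {0..})"
proof (rule bdd_belowI2)
  fix s :: real assume "s \<in> {0..}"
  then have s: "0 \<le> s" by simp
  have "q (s *\<^sub>R g) \<le> q (a + s *\<^sub>R g) + q (- a)"
    using max_sublinearD(1)[OF assms, of "a + s *\<^sub>R g" "- a"] by simp
  then show "- q (- a) \<le> q (a + s *\<^sub>R g) - s * q g"
    by (simp add: max_sublinear_scaleR[OF assms s])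
qed

lemma peak_le:
  assumes "max_sublinear q" "0 \<le> s"
  shows "peak q g a \<le> q (a + s *\<^sub>R g) - s * q g"
  unfolding peak_def using peak_bdd_below[OF assms(1)] assms(2) by (intro cINF_lower) auto

text \<open>Adding \<open>s *\<^sub>R g\<close> commutes with suprema, so each term of the infimum turns suprema into maxima.
  Subadditivity couples different terms: those for \<open>s\<close> at \<open>a\<close> and at \<open>b\<close> bound the one for \<open>2 * s\<close>
  at \<open>a + b\<close>.\<close>

lemma max_sublinear_peak:
  assumes "max_sublinear q"
  shows "max_sublinear (peak q g)"
proof -
  note D = max_sublinearD[OF assms]
  show ?thesis
    unfolding peak_def
  proof (rule max_sublinear_INF_directed, goal_cases)
    case 1
    show ?case by auto
  next
    case (2 s a b)
    then have "0 \<le> s" by simp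
    then show ?case
      using peak_le[OF assms, of "2 * s" g "a + b"] D(1)[of "a + s *\<^sub>R g" "b + s *\<^sub>R g"]
      by (simp add: peak_def algebra_simps scaleR_2[symmetric])
  next
    case (3 s a b)
    show ?case
      using D(3)[of "a + s *\<^sub>R g" "b + s *\<^sub>R g"] by (simp add: add_sup_distrib_right max_def)
  next
    case (4 a)
    show ?case by (rule peak_bdd_below[OF assms])
  next
    case (5 s s')
    have "q (a + y *\<^sub>R g) - y * q g \<le> q (a + x *\<^sub>R g) - x * q g" if "x \<le> y" for a x y
      using D(1)[of "a + x *\<^sub>R g" "(y - x) *\<^sub>R g"] max_sublinear_scaleR[OF assms, of "y - x" g] that
      by (simp add: algebra_simps)
    with 5 show ?case
      by (intro bexI[of _ "max s s'"]) (auto simp: le_fun_def)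
  next
    case (6 s r a)
    then show ?case
      using peak_le[OF assms, of "r * s" g "r *\<^sub>R a"] D(2)[of r "a + s *\<^sub>R g"]
      by (simp add: peak_def algebra_simps)
  qed
qed

text \<open>Zorn's lemma for the reversed pointwise order. Chains are bounded pointwise because any \<open>q \<le> p\<close>
  satisfies \<open>- p (- a) \<le> - q (- a) \<le> q a\<close>.\<close>

lemma minimal_max_sublinear_exists:
  assumes "max_sublinear p"
  obtains q where "max_sublinear q" "q \<le> p" "\<And>q'. max_sublinear q' \<Longrightarrow> q' \<le> q \<Longrightarrow> q' = q"
proof -
  define A where "A = {q. max_sublinear q \<and> q \<le> p}"
  have "\<exists>m\<in>A. \<forall>a\<in>A. a \<le> m \<longrightarrow> a = m"
  proof (rule predicate_Zorn[of A "\<lambda>x y. y \<le> x"])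
    show "partial_order_on A (relation_of (\<lambda>x y. y \<le> x) A)"
      by (auto intro!: partial_order_on_relation_ofI)
    fix C assume "C \<in> Chains (relation_of (\<lambda>x y. y \<le> x) A)"
    then have CA: "C \<subseteq> A" and chain: "\<And>x y. x \<in> C \<Longrightarrow> y \<in> C \<Longrightarrow> x \<le> y \<or> y \<le> x"
      by (auto simp: Chains_def relation_of_def)
    show "\<exists>u\<in>A. \<forall>a\<in>C. u \<le> a"
    proof (cases "C = {}")
      case True
      then show ?thesis using assms by (auto simp: A_def)
    next
      case False
      define u where "u = (\<lambda>a. INF q\<in>C. q a)"
      have C: "max_sublinear q" "q a \<le> p a" if "q \<in> C" for q a
        using CA that by (auto simp: A_def le_fun_def)
      have bd: "bdd_below ((\<lambda>q. q a) ` C)" for a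
      proof (rule bdd_belowI2)
        fix q assume "q \<in> C"
        then show "- p (- a) \<le> q a"
          using C(2)[of q "- a"] max_sublinear_neg[OF C(1), of q a] by simp
      qed
      have low: "u a \<le> q a" if "q \<in> C" for q a
        unfolding u_def using bd that by (rule cINF_lower)
      have "max_sublinear u"
        unfolding u_def
      proof (rule max_sublinear_INF_directed[OF False])
        show "(INF j\<in>C. j (a + b)) \<le> q a + q b" if "q \<in> C" for q a b
          using low[OF that, of "a + b"] max_sublinearD(1)[OF C(1)[OF that], of a b]
          by (simp add: u_def)
        show "(INF j\<in>C. j (r *\<^sub>R a)) \<le> r * q a" if "q \<in> C" "r > 0" for q r a
          using low[OF that(1), of "r *\<^sub>R a"] max_sublinearD(2)[OF C(1)[OF that(1)] that(2), of a]
          by (simp add: u_def)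
        show "\<exists>k\<in>C. k \<le> q \<and> k \<le> q'" if "q \<in> C" "q' \<in> C" for q q'
          using chain[OF that] that by blast
      qed (use bd max_sublinearD(3)[OF C(1)] in auto)
      moreover have "u \<le> p"
      proof (rule le_funI)
        fix a
        obtain q where "q \<in> C" using False by blast
        then show "u a \<le> p a" using low[of q a] C(2)[of q a] by simp
      qed
      ultimately show ?thesis
        using low by (auto simp: A_def le_fun_def)
    qed
  qed
  then obtain m where m: "m \<in> A" "\<And>a. a \<in> A \<Longrightarrow> a \<le> m \<Longrightarrow> a = m" by blast
  show thesis
    by (rule that[of m]) (use m in \<open>auto simp: A_def dest: order_trans\<close>)
qed

text \<open>Minimality forces \<open>peak q g = q\<close> for every \<open>g\<close>, and \<open>peak q g (- g) \<le> - q g\<close>. Thus \<open>q\<close> is odd,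
  and an odd sublinear functional is linear.\<close>

lemma minimal_max_sublinear_riesz_hom:
  assumes "max_sublinear q" "\<And>q'. max_sublinear q' \<Longrightarrow> q' \<le> q \<Longrightarrow> q' = q"
  shows "riesz_hom q"
proof (rule riesz_homI)
  note D = max_sublinearD[OF assms(1)]
  have neg: "q (- g) = - q g" for g
  proof -
    have "peak q g \<le> q"
      using peak_le[OF assms(1), of 0 g] by (auto simp: le_fun_def)
    then have "peak q g = q"
      by (intro assms(2) max_sublinear_peak[OF assms(1)])
    then have "q (- g) \<le> - q g"
      using peak_le[OF assms(1), of 1 g "- g"] max_sublinear_zero[OF assms(1)] by simp
    then show ?thesis
      using max_sublinear_neg[OF assms(1), of g] by simp
  qed
  show "linear q"
  proof (rule linearI)
    show "q (a + b) = q a + q b" for a b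
      using D(1)[of a b] D(1)[of "- a" "- b"] neg[of "a + b"] neg[of a] neg[of b] by simp
    show "q (r *\<^sub>R a) = r *\<^sub>R q a" for r a
      using max_sublinear_scaleR[OF assms(1), of r a] max_sublinear_scaleR[OF assms(1), of "- r" a]
        neg[of "r *\<^sub>R a"] by (cases "0 \<le> r") auto
  qed
  show "q (sup a b) = max (q a) (q b)" for a b by (rule D(3))
qed

text \<open>A homomorphism below \<open>peak p f\<close> attains \<open>p\<close> at \<open>f\<close> automatically, because
  \<open>peak p f (- f) \<le> - p f\<close>.\<close>

lemma riesz_hom_attaining:
  assumes "max_sublinear p"
  obtains u where "riesz_hom u" "\<And>a. u a \<le> p a" "u f = p f"
proof -
  obtain u where u: "max_sublinear u" "u \<le> peak p f" "\<And>q'. max_sublinear q' \<Longrightarrow> q' \<le> u \<Longrightarrow> q' = u"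
    by (rule minimal_max_sublinear_exists[OF max_sublinear_peak[OF assms, of f]]) (rule that)
  have hom: "riesz_hom u"
    using u(1,3) by (rule minimal_max_sublinear_riesz_hom)
  have le: "u a \<le> p a" for a
    using le_funD[OF u(2), of a] peak_le[OF assms, of 0 f a] by simp
  have "u (- f) \<le> - p f"
    using le_funD[OF u(2), of "- f"] peak_le[OF assms, of 1 f "- f"] max_sublinear_zero[OF assms]
    by simp
  then have "u f = p f"
    using le[of f] linear_neg[of u f] hom by (simp add: riesz_hom_def)
  with hom le show thesis by (rule that)
qed

section \<open>The gauge of a sup-closed set of positive elements\<close>

text \<open>For solid \<open>P\<close> this is the Minkowski gauge of \<open>P\<close>, evaluated at the positive part of \<open>a\<close>. Bounding
  \<open>a\<close> itself by a multiple of an element of \<open>P\<close> avoids positive parts.\<close>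

definition gauge_of :: "'a::riesz_space set \<Rightarrow> 'a \<Rightarrow> real"
  where "gauge_of P a = Inf {r. r > 0 \<and> (\<exists>g\<in>P. a \<le> r *\<^sub>R g)}"

lemma gauge_of_le:
  assumes "r > 0" "g \<in> P" "a \<le> r *\<^sub>R g"
  shows "gauge_of P a \<le> r"
  unfolding gauge_of_def
proof (rule cInf_lower)
  show "bdd_below {r. r > 0 \<and> (\<exists>g\<in>P. a \<le> r *\<^sub>R g)}"
    by (rule bdd_belowI[of _ 0]) simp
qed (use assms in auto)

lemma gauge_of_less:
  assumes pos: "P \<subseteq> {0..}"
    and absorbing: "\<forall>a. \<exists>r>0. \<exists>g\<in>P. a \<le> r *\<^sub>R g"
    and "gauge_of P a < r"
  shows "r > 0 \<and> (\<exists>g\<in>P. a \<le> r *\<^sub>R g)"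
proof -
  have "{r. r > 0 \<and> (\<exists>g\<in>P. a \<le> r *\<^sub>R g)} \<noteq> {}"
    using absorbing[rule_format, of a] by auto
  from cInf_lessD[OF this assms(3)[unfolded gauge_of_def]]
  obtain s g where s: "0 < s" "s < r" and g: "g \<in> P" "a \<le> s *\<^sub>R g"
    by auto
  have "a \<le> r *\<^sub>R g"
    using g(2) scaleR_right_mono[of s r g] s g(1) pos by auto
  then show ?thesis
    using s g(1) by auto
qed

text \<open>If \<open>a \<le> r *\<^sub>R g\<close> and \<open>b \<le> s *\<^sub>R h\<close> with \<open>g\<close> and \<open>h\<close> in \<open>P\<close>, then both bounds hold with \<open>sup g h\<close> in
  place of \<open>g\<close> and \<open>h\<close>. So closure under suprema replaces convexity of \<open>P\<close> in the
  proof of subadditivity, and it also gives the maximum rule.\<close>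

lemma max_sublinear_gauge_of:
  assumes pos: "P \<subseteq> {0..}"
    and absorbing: "\<forall>a. \<exists>r>0. \<exists>g\<in>P. a \<le> r *\<^sub>R g"
    and sup: "\<And>g h. g \<in> P \<Longrightarrow> h \<in> P \<Longrightarrow> sup g h \<in> P"
  shows "max_sublinear (gauge_of P)"
  unfolding max_sublinear_def
proof (intro conjI allI impI)
  let ?p = "gauge_of P"
  have less: "r > 0 \<and> (\<exists>g\<in>P. a \<le> r *\<^sub>R g)" if "?p a < r" for a r
    using pos absorbing that by (rule gauge_of_less)
  show "?p (a + b) \<le> ?p a + ?p b" for a b
  proof (rule field_le_epsilon)
    fix e :: real assume "e > 0"
    obtain g where g: "?p a + e/2 > 0" "g \<in> P" "a \<le> (?p a + e/2) *\<^sub>R g"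
      using less[of a "?p a + e/2"] \<open>e > 0\<close> by auto
    obtain h where h: "?p b + e/2 > 0" "h \<in> P" "b \<le> (?p b + e/2) *\<^sub>R h"
      using less[of b "?p b + e/2"] \<open>e > 0\<close> by auto
    have "a \<le> (?p a + e/2) *\<^sub>R sup g h" "b \<le> (?p b + e/2) *\<^sub>R sup g h"
      using g h by (auto intro: le_scaleR_trans)
    then have "a + b \<le> (?p a + e/2 + (?p b + e/2)) *\<^sub>R sup g h"
      by (simp only: scaleR_add_left add_mono)
    from gauge_of_le[OF _ sup[OF g(2) h(2)] this] show "?p (a + b) \<le> ?p a + ?p b + e"
      using g(1) h(1) by simp
  qed
  have scale: "?p (r *\<^sub>R a) \<le> r * ?p a" if r: "r > 0" for r a
  proof (rule field_le_epsilon)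
    fix e :: real assume "e > 0"
    then obtain g where g: "?p a + e/r > 0" "g \<in> P" "a \<le> (?p a + e/r) *\<^sub>R g"
      using less[of a "?p a + e/r"] r by auto
    then have "r *\<^sub>R a \<le> (r * (?p a + e/r)) *\<^sub>R g"
      using scaleR_left_mono[OF g(3), of r] r by simp
    then have "?p (r *\<^sub>R a) \<le> r * (?p a + e/r)"
      using gauge_of_le[OF _ g(2), of "r * (?p a + e/r)"] g(1) r by simp
    then show "?p (r *\<^sub>R a) \<le> r * ?p a + e"
      using r by (simp add: distrib_left)
  qed
  show "?p (r *\<^sub>R a) = r * ?p a" if "r > 0" for r a
    using scale[OF that, of a] scale[of "1/r" "r *\<^sub>R a"] that by (simp add: field_simps)
  have mono: "?p a \<le> ?p b" if ab: "a \<le> b" for a b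
  proof (rule field_le_epsilon)
    fix e :: real assume "e > 0"
    then obtain g where "?p b + e > 0" "g \<in> P" "b \<le> (?p b + e) *\<^sub>R g"
      using less[of b "?p b + e"] by auto
    then show "?p a \<le> ?p b + e"
      using gauge_of_le[of "?p b + e" g P a] ab by auto
  qed
  show "?p (sup a b) = max (?p a) (?p b)" for a b
  proof (rule antisym)
    show "?p (sup a b) \<le> max (?p a) (?p b)"
    proof (rule field_le_epsilon)
      fix e :: real assume "e > 0"
      let ?m = "max (?p a) (?p b) + e"
      have lt: "?p a < ?m" "?p b < ?m"
        using \<open>e > 0\<close> max.cobounded1[of "?p a" "?p b"] max.cobounded2[of "?p b" "?p a"] by linarith+
      obtain g where g: "?m > 0" "g \<in> P" "a \<le> ?m *\<^sub>R g"
        using less[OF lt(1)] by blast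
      obtain h where h: "h \<in> P" "b \<le> ?m *\<^sub>R h"
        using less[OF lt(2)] by blast
      have "sup a b \<le> ?m *\<^sub>R sup g h"
        using le_scaleR_trans[OF g(3), of "sup g h"] le_scaleR_trans[OF h(2), of "sup g h"] g(1)
        by auto
      then show "?p (sup a b) \<le> ?m"
        using gauge_of_le[OF g(1) sup[OF g(2) h(1)]] by simp
    qed
  qed (use mono in auto)
qed

section \<open>The fixed points of a truncation\<close>

lemma truncation_le:
  assumes "truncation t" "0 \<le> f"
  shows "t f \<le> f"
proof -
  have "inf (t f) (t f) = inf f (t (t f))"
    using assms unfolding truncation_def by blast
  then show ?thesis
    by (metis inf.idem inf_le1)
qed

lemma trunc_fixed_nonneg: "trunc_fixed t \<subseteq> {0..}"
  by (auto simp: trunc_fixed_def)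

text \<open>With \<open>truncation_le\<close> and \<open>truncation_in_trunc_fixed\<close>: \<open>t f\<close> is the greatest fixed point
  below \<open>f\<close>, so the truncation is determined by its fixed points.\<close>

lemma truncation_greatest:
  assumes "truncation t" "0 \<le> f" "g \<in> trunc_fixed t" "g \<le> f"
  shows "g \<le> t f"
proof -
  have "inf (t g) f = inf g (t f)"
    using assms unfolding truncation_def trunc_fixed_def by blast
  then show ?thesis
    using assms(3,4) by (simp add: trunc_fixed_def inf.absorb1) (metis inf_le2)
qed

lemma trunc_fixed_solid:
  assumes "truncation t" "g \<in> trunc_fixed t" "0 \<le> f" "f \<le> g"
  shows "f \<in> trunc_fixed t"
proof -
  have "inf (t f) g = inf f (t g)"
    using assms unfolding truncation_def trunc_fixed_def by blast
  also have "\<dots> = f"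
    using assms by (simp add: trunc_fixed_def inf.absorb1)
  finally have "f \<le> t f"
    by (metis inf_le1)
  with truncation_le[OF assms(1,3)] assms(3) show ?thesis
    by (simp add: trunc_fixed_def antisym)
qed

lemma truncation_in_trunc_fixed:
  assumes "truncation t" "0 \<le> f"
  shows "t f \<in> trunc_fixed t"
proof -
  have tf: "0 \<le> t f"
    using assms unfolding truncation_def by blast
  have "inf (t f) (t f) = inf f (t (t f))"
    using assms(1,2) tf unfolding truncation_def by blast
  then have "t f \<le> t (t f)"
    by (metis inf.idem inf_le2)
  with truncation_le[OF assms(1) tf] tf show ?thesis
    by (simp add: trunc_fixed_def antisym)
qed

lemma trunc_fixed_sup:
  assumes "truncation t" "f \<in> trunc_fixed t" "g \<in> trunc_fixed t"
  shows "sup f g \<in> trunc_fixed t"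
proof -
  have nn: "0 \<le> sup f g"
    using assms(2) by (auto simp: trunc_fixed_def intro: le_supI1)
  then have "sup f g \<le> t (sup f g)"
    using truncation_greatest[OF assms(1) nn] assms(2,3) by simp
  with truncation_le[OF assms(1) nn] nn show ?thesis
    by (simp add: trunc_fixed_def antisym)
qed

lemma strong_truncation_absorbing:
  fixes t :: "'a::riesz_space \<Rightarrow> 'a"
  assumes "strong_truncation t"
  shows "\<forall>a. \<exists>r>0. \<exists>g\<in>trunc_fixed t. a \<le> r *\<^sub>R g"
proof
  fix a :: 'a
  have "0 \<le> sup a 0" by simp
  then obtain e where e: "e > 0" "e *\<^sub>R sup a 0 \<in> trunc_fixed t"
    using assms unfolding strong_truncation_def by blast
  have "a \<le> (1/e) *\<^sub>R (e *\<^sub>R sup a 0)"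
    using e(1) by simp
  with e show "\<exists>r>0. \<exists>g\<in>trunc_fixed t. a \<le> r *\<^sub>R g"
    by (intro exI[of _ "1/e"] conjI bexI[of _ "e *\<^sub>R sup a 0"]) auto
qed

lemma max_sublinear_gauge_of_trunc_fixed:
  assumes "strong_truncation t"
  shows "max_sublinear (gauge_of (trunc_fixed t))"
  using assms trunc_fixed_sup
  by (intro max_sublinear_gauge_of trunc_fixed_nonneg strong_truncation_absorbing)
     (auto simp: strong_truncation_def)

text \<open>If the gauge of \<open>f\<close> vanishes, every positive multiple of \<open>f\<close> lies below a fixed point, hence is one
  by solidity.\<close>

lemma gauge_of_trunc_fixed_pos:
  assumes "strong_truncation t" "0 \<le> f" "\<not> infinitely_small t f"
  shows "0 < gauge_of (trunc_fixed t) f"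
proof (rule ccontr)
  assume np: "\<not> ?thesis"
  have tr: "truncation t"
    using assms(1) by (simp add: strong_truncation_def)
  have abs: "riesz_abs f = f"
    using assms(2) by (simp add: sup.absorb1 minus_le_self_iff)
  have "e *\<^sub>R f \<in> trunc_fixed t" if "e > 0" for e
  proof -
    have "gauge_of (trunc_fixed t) f < 1/e"
      using np that by (auto intro: le_less_trans[of _ 0])
    then obtain g where g: "g \<in> trunc_fixed t" "f \<le> (1/e) *\<^sub>R g"
      using gauge_of_less[OF trunc_fixed_nonneg strong_truncation_absorbing[OF assms(1)]] by blast
    have "e *\<^sub>R f \<le> g"
      using scaleR_left_mono[OF g(2), of e] that by simp
    then show ?thesis
      using trunc_fixed_solid[OF tr g(1)] scaleR_nonneg_nonneg[of e f] that assms(2) by simp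
  qed
  with assms(3) abs show False
    by (simp add: infinitely_small_def)
qed

section \<open>Sufficiently many homomorphisms into the reals\<close>

lemma riesz_hom_mono:
  fixes u :: "'a::riesz_space \<Rightarrow> real"
  assumes "riesz_hom u" "a \<le> b"
  shows "u a \<le> u b"
proof -
  have "u (sup a b) = sup (u a) (u b)"
    using assms(1) by (simp add: riesz_hom_def)
  then show ?thesis
    using assms(2) by (simp add: sup.absorb2) (metis sup.cobounded1)
qed

text \<open>The hypotheses say that the supremum of \<open>u\<close> over the fixed points is \<open>1\<close>. The inequality
  \<open>u (t f) \<le> min 1 (u f)\<close> uses that \<open>t f\<close> is a fixed point below \<open>f\<close>; the other one uses that for
  any fixed point \<open>g\<close> the fixed point \<open>inf f g\<close> lies below \<open>t f\<close>.\<close>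

lemma star_hom_realI:
  fixes u :: "'a::riesz_space \<Rightarrow> real"
  assumes tr: "truncation t" and u: "riesz_hom u"
    and le1: "\<And>g. g \<in> trunc_fixed t \<Longrightarrow> u g \<le> 1"
    and near1: "\<And>c. c < 1 \<Longrightarrow> \<exists>g\<in>trunc_fixed t. c < u g"
  shows "star_hom t (min 1) u"
proof -
  have "u (t f) = min 1 (u f)" if f: "0 \<le> f" for f
  proof (rule antisym)
    show "u (t f) \<le> min 1 (u f)"
      using le1[OF truncation_in_trunc_fixed[OF tr f]] riesz_hom_mono[OF u truncation_le[OF tr f]]
      by simp
    show "min 1 (u f) \<le> u (t f)"
    proof (rule dense_le)
      fix c assume c: "c < min 1 (u f)"
      then obtain g where g: "g \<in> trunc_fixed t" "c < u g"
        using near1[of c] by auto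
      have g0: "0 \<le> g"
        using g(1) by (simp add: trunc_fixed_def)
      have "inf f g \<in> trunc_fixed t"
        using g0 f by (intro trunc_fixed_solid[OF tr g(1)]) auto
      then have "inf f g \<le> t f"
        by (rule truncation_greatest[OF tr f]) simp
      then have "u (inf f g) \<le> u (t f)"
        by (rule riesz_hom_mono[OF u])
      moreover have "u (inf f g) = min (u f) (u g)"
        using u by (simp add: riesz_hom_def inf_min)
      ultimately show "c \<le> u (t f)"
        using c g(2) by (auto simp: min_def split: if_splits)
    qed
  qed
  with u show ?thesis by (simp add: star_hom_def)
qed

text \<open>A Riesz homomorphism \<open>u\<close> below the gauge \<open>p\<close> is at most \<open>1\<close> on fixed points. If moreover
  \<open>u f = p f > 0\<close>, its supremum there is \<open>1\<close>: for \<open>s\<close> slightly larger than \<open>p f\<close> there is a fixed point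
  \<open>g\<close> with \<open>f \<le> s *\<^sub>R g\<close>, whence \<open>u g \<ge> p f / s\<close>.\<close>

lemma spectrum_separates:
  assumes "strong_truncation t" "0 \<le> f" "\<not> infinitely_small t f"
  shows "\<exists>u\<in>spectrum t. 0 < u f"
proof -
  let ?P = "trunc_fixed t"
  let ?p = "gauge_of ?P"
  have tr: "truncation t"
    using assms(1) by (simp add: strong_truncation_def)
  have pos: "0 < ?p f"
    by (rule gauge_of_trunc_fixed_pos[OF assms])
  obtain u where u: "riesz_hom u" "\<And>a. u a \<le> ?p a" "u f = ?p f"
    by (rule riesz_hom_attaining[OF max_sublinear_gauge_of_trunc_fixed[OF assms(1)], of f]) (rule that)
  have "star_hom t (min 1) u"
  proof (rule star_hom_realI[OF tr u(1)])
    show "u g \<le> 1" if "g \<in> ?P" for g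
      using u(2)[of g] gauge_of_le[of 1 g ?P g] that by simp
    show "\<exists>g\<in>?P. c < u g" if "c < 1" for c
    proof -
      \<comment> \<open>only a positive lower bound can be divided by, so \<open>c\<close> is first raised to \<open>1/2\<close>\<close>
      define d where "d = max c (1/2)"
      have d: "0 < d" "d < 1" "c \<le> d"
        using that by (auto simp: d_def)
      have "?p f < ?p f / d"
        using pos d by (simp add: pos_less_divide_eq)
      from dense[OF this] obtain s where s: "?p f < s" "s < ?p f / d"
        by blast
      obtain g where g: "g \<in> ?P" "f \<le> s *\<^sub>R g"
        using gauge_of_less[OF trunc_fixed_nonneg strong_truncation_absorbing[OF assms(1)] s(1)] by blast
      have "?p f \<le> u (s *\<^sub>R g)"
        using riesz_hom_mono[OF u(1) g(2)] u(3) by simp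
      also have "u (s *\<^sub>R g) = s * u g"
        using u(1) by (simp add: riesz_hom_def linear_cmul)
      finally have ps: "?p f \<le> s * u g" .
      have "d * s < ?p f"
        using s(2) d(1) by (simp add: pos_less_divide_eq mult.commute)
      then have "s * d < s * u g"
        using ps by (simp add: mult.commute)
      then have "d < u g"
        using s(1) pos by simp
      with g(1) d(3) show ?thesis by (intro bexI[of _ g]) auto
    qed
  qed
  moreover have "u \<noteq> (\<lambda>f. 0)"
    using u(3) pos by auto
  ultimately show ?thesis
    using u(3) pos by (intro bexI[of _ u]) (auto simp: spectrum_def)
qed

section \<open>Uniform approximation from lattices of functions\<close>

text \<open>Finitely many of the open sets where some \<open>f \<in> F\<close> is below \<open>h\<close> cover the compact set; a lower
  bound in \<open>F\<close> of the corresponding functions is below \<open>h\<close> everywhere.\<close>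

lemma compact_inf_closed_below:
  fixes F :: "('b::topological_space \<Rightarrow> real) set"
  assumes X: "compact X" "X \<noteq> {}"
    and cont: "\<And>f. f \<in> F \<Longrightarrow> continuous_on X f" "continuous_on X h"
    and inf: "\<And>f g. f \<in> F \<Longrightarrow> g \<in> F \<Longrightarrow> inf f g \<in> F"
    and below: "\<And>x. x \<in> X \<Longrightarrow> \<exists>f\<in>F. f x < h x"
  shows "\<exists>g\<in>F. \<forall>x\<in>X. g x < h x"
proof -
  have "\<exists>U. open U \<and> U \<inter> X = {x \<in> X. f x < h x}" if "f \<in> F" for f
  proof -
    have "continuous_on X (\<lambda>x. f x - h x)"
      using cont that by (intro continuous_intros) auto
    from this[unfolded continuous_on_open_invariant, rule_format, of "{..<0}"]
    show ?thesis by (auto simp: vimage_def)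
  qed
  then obtain U where U: "\<And>f. f \<in> F \<Longrightarrow> open (U f)" "\<And>f. f \<in> F \<Longrightarrow> U f \<inter> X = {x \<in> X. f x < h x}"
    by metis
  have "X \<subseteq> (\<Union>f\<in>F. U f)"
  proof
    fix x assume "x \<in> X"
    then obtain f where "f \<in> F" "f x < h x" using below by blast
    with U(2)[of f] \<open>x \<in> X\<close> show "x \<in> (\<Union>f\<in>F. U f)" by blast
  qed
  from compactE_image[OF X(1) U(1) this]
  obtain G where G: "G \<subseteq> F" "finite G" "X \<subseteq> (\<Union>f\<in>G. U f)" by blast
  have lower: "\<exists>g\<in>F. \<forall>f\<in>G. g \<le> f"
    if "finite G" "G \<noteq> {}" "G \<subseteq> F" for G
    using that
  proof (induction rule: finite_ne_induct)
    case (singleton f)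
    then show ?case by auto
  next
    case (insert f G)
    then obtain g where g: "g \<in> F" "\<forall>f\<in>G. g \<le> f" by auto
    show ?case
    proof (intro bexI ballI)
      show "inf f g \<in> F" using inf insert.prems g(1) by simp
      show "inf f g \<le> k" if "k \<in> insert f G" for k
        using that g(2) by (metis insert_iff inf_le1 inf_le2 order_trans)
    qed
  qed
  have "G \<noteq> {}"
    using G(3) X(2) by auto
  from lower[OF G(2) this G(1)] obtain g where g: "g \<in> F" "\<forall>f\<in>G. g \<le> f"
    by blast
  have "g x < h x" if "x \<in> X" for x
  proof -
    obtain f where f: "f \<in> G" "x \<in> U f"
      using G(3) \<open>x \<in> X\<close> by blast
    then have "f x < h x"
      using U(2)[of f] G(1) that by blast
    moreover have "g x \<le> f x"
      using g(2) f(1) by (simp add: le_fun_def)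
    ultimately show ?thesis by simp
  qed
  with g(1) show ?thesis by blast
qed

text \<open>The Kakutani-Stone theorem: compactness is used once with infima, to approximate \<open>h\<close> from above
  by functions that agree with \<open>h\<close> at a prescribed point, and once with suprema of the functions so
  obtained. Interpolation takes the place of constants in \<open>L\<close>, since it also makes
  sense when all functions vanish at some point, as evaluations do at the zero functional.\<close>

lemma lattice_Stone_Weierstrass:
  fixes L :: "('b::topological_space \<Rightarrow> real) set"
  assumes X: "compact X" "X \<noteq> {}"
    and cont: "\<And>f. f \<in> L \<Longrightarrow> continuous_on X f" "continuous_on X h"
    and inf: "\<And>f g. f \<in> L \<Longrightarrow> g \<in> L \<Longrightarrow> inf f g \<in> L"
    and sup: "\<And>f g. f \<in> L \<Longrightarrow> g \<in> L \<Longrightarrow> sup f g \<in> L"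
    and interpolate: "\<And>x y. x \<in> X \<Longrightarrow> y \<in> X \<Longrightarrow> \<exists>f\<in>L. f x = h x \<and> f y = h y"
    and "e > 0"
  shows "\<exists>g\<in>L. \<forall>x\<in>X. \<bar>h x - g x\<bar> < e"
proof -
  have one_sided: "\<exists>g\<in>L. g x = h x \<and> (\<forall>y\<in>X. g y < h y + e)" if x: "x \<in> X" for x
  proof -
    have "\<exists>g\<in>{f\<in>L. f x = h x}. \<forall>y\<in>X. g y < h y + e"
    proof (rule compact_inf_closed_below[OF X])
      show "\<exists>f\<in>{f\<in>L. f x = h x}. f y < h y + e" if y: "y \<in> X" for y
        using interpolate[OF x y] \<open>e > 0\<close> by force
    qed (use cont inf in \<open>auto intro!: continuous_intros\<close>)
    then show ?thesis by blast
  qed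
  \<comment> \<open>the second use of compactness is the first one applied to negatives\<close>
  define F where "F = {f. - f \<in> L \<and> (\<forall>y\<in>X. - f y < h y + e)}"
  have "\<exists>g\<in>F. \<forall>x\<in>X. g x < - h x + e"
  proof (rule compact_inf_closed_below[OF X])
    show "continuous_on X f" if "f \<in> F" for f
    proof -
      have "continuous_on X (- f)"
        using that by (intro cont) (simp add: F_def)
      then have "continuous_on X (\<lambda>x. - (- f) x)"
        by (rule continuous_on_minus)
      then show ?thesis by simp
    qed
    show "inf f g \<in> F" if "f \<in> F" "g \<in> F" for f g
    proof -
      have "- inf f g = sup (- f) (- g)"
        by (simp add: fun_eq_iff inf_min sup_max min_def max_def)
      then show ?thesis
        using sup[of "- f" "- g"] that by (auto simp: F_def inf_min min_def)
    qed
    show "\<exists>f\<in>F. f x < - h x + e" if x: "x \<in> X" for x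
    proof -
      obtain g where g: "g \<in> L" "g x = h x" "\<forall>y\<in>X. g y < h y + e"
        using one_sided[OF x] by blast
      then show ?thesis
        using \<open>e > 0\<close> by (intro bexI[of _ "- g"]) (auto simp: F_def)
    qed
  qed (use cont in \<open>auto intro!: continuous_intros\<close>)
  then obtain g where g: "g \<in> F" "\<forall>x\<in>X. g x < - h x + e" by blast
  then show ?thesis
    by (intro bexI[of _ "- g"]) (force simp: F_def abs_less_iff)+
qed

section \<open>The spectrum and its compactification by the zero functional\<close>

text \<open>The spectrum together with the zero functional, which serves as its point at infinity.\<close>

definition star_homs :: "('a::riesz_space \<Rightarrow> 'a) \<Rightarrow> ('a \<Rightarrow> real) set"
  where "star_homs t = {u. star_hom t (min 1) u}"

lemma star_homsD:
  assumes "u \<in> star_homs t"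
  shows "u (a + b) = u a + u b" "u (r *\<^sub>R a) = r * u a" "u (a - b) = u a - u b"
    "u (- a) = - u a" "u 0 = 0"
    "u (sup a b) = max (u a) (u b)" "u (inf a b) = min (u a) (u b)"
    "0 \<le> c \<Longrightarrow> u (t c) = min 1 (u c)"
proof -
  have u: "linear u" "\<forall>a b. u (sup a b) = sup (u a) (u b)" "\<forall>a b. u (inf a b) = inf (u a) (u b)"
    "\<forall>f\<ge>0. u (t f) = min 1 (u f)"
    using assms unfolding star_homs_def star_hom_def riesz_hom_def by blast+
  show "u (a + b) = u a + u b" "u (r *\<^sub>R a) = r * u a" "u (a - b) = u a - u b"
    "u (- a) = - u a" "u 0 = 0"
    using linear_add[OF u(1)] linear_cmul[OF u(1)] linear_diff[OF u(1)] linear_neg[OF u(1)]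
      linear_0[OF u(1)] by auto
  show "u (sup a b) = max (u a) (u b)" "u (inf a b) = min (u a) (u b)"
    "0 \<le> c \<Longrightarrow> u (t c) = min 1 (u c)"
    using u(2,3,4) by (auto simp: sup_max inf_min)
qed

lemma star_homs_riesz_abs:
  assumes "u \<in> star_homs t"
  shows "u (riesz_abs f) = \<bar>u f\<bar>"
  by (simp add: star_homsD(4,6)[OF assms] abs_real_def max_def)

lemma spectrum_eq: "spectrum t = star_homs t - {\<lambda>f. 0}"
  by (auto simp: spectrum_def star_homs_def)

lemma spectrum_subset_star_homs: "spectrum t \<subseteq> star_homs t"
  by (auto simp: spectrum_eq)

lemma riesz_abs_nonneg:
  fixes f :: "'a::riesz_space"
  shows "0 \<le> riesz_abs f"
proof -
  have "0 \<le> riesz_abs f + riesz_abs f"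
    using add_mono[of f "riesz_abs f" "- f" "riesz_abs f"] by simp
  then show ?thesis by (simp only: zero_le_double_add_iff_zero_le_single_add)
qed

lemma zero_in_star_homs: "(\<lambda>f. 0) \<in> star_homs t"
  by (auto simp: star_homs_def star_hom_def riesz_hom_def linear_iff)

text \<open>Strength provides \<open>e > 0\<close> such that \<open>e *\<^sub>R riesz_abs f\<close> is a fixed point, and homomorphisms take
  values at most \<open>1\<close> on fixed points.\<close>

lemma star_homs_bounded:
  assumes "strong_truncation t"
  shows "\<exists>M. \<forall>u\<in>star_homs t. \<bar>u f\<bar> \<le> M"
proof -
  obtain e where e: "e > 0" "e *\<^sub>R riesz_abs f \<in> trunc_fixed t"
    using assms riesz_abs_nonneg[of f] unfolding strong_truncation_def by blast
  have "\<bar>u f\<bar> \<le> 1 / e" if u: "u \<in> star_homs t" for u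
  proof -
    have "u (t (e *\<^sub>R riesz_abs f)) = min 1 (u (e *\<^sub>R riesz_abs f))"
      using e(1) riesz_abs_nonneg[of f] by (intro star_homsD(8)[OF u] scaleR_nonneg_nonneg) auto
    moreover have "t (e *\<^sub>R riesz_abs f) = e *\<^sub>R riesz_abs f"
      using e(2) by (simp add: trunc_fixed_def)
    moreover have "u (e *\<^sub>R riesz_abs f) = e * \<bar>u f\<bar>"
      by (simp only: star_homsD(2)[OF u] star_homs_riesz_abs[OF u])
    ultimately have "e * \<bar>u f\<bar> \<le> 1"
      by (simp add: min_def split: if_splits)
    then show ?thesis
      using e(1) by (simp add: pos_le_divide_eq mult.commute)
  qed
  then show ?thesis by blast
qed

lemma closed_star_homs: "closed (star_homs t)"
  unfolding star_homs_def star_hom_def riesz_hom_def linear_iff sup_max inf_min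
  by (intro closed_Collect_conj closed_Collect_all closed_Collect_imp closed_Collect_eq
      continuous_intros continuous_on_product_coordinates) auto

text \<open>Tychonoff's theorem for the product of the intervals given by \<open>star_homs_bounded\<close>. This fails for
  the spectrum alone, which need not be closed: its points may converge to the zero functional.\<close>

lemma compact_star_homs:
  assumes "strong_truncation t"
  shows "compact (star_homs t)"
proof -
  obtain M where M: "\<And>f u. u \<in> star_homs t \<Longrightarrow> \<bar>u f\<bar> \<le> M f"
    using star_homs_bounded[OF assms] by metis
  have "compactin (powertop_real UNIV) (Pi\<^sub>E UNIV (\<lambda>f. {- M f..M f}))"
    by (simp add: compactin_PiE)
  then have "compact (Pi\<^sub>E UNIV (\<lambda>f. {- M f..M f}))"
    by (simp add: euclidean_product_topology)
  from compact_Int_closed[OF this closed_star_homs[of t]]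
  show ?thesis
    using M by (auto simp: PiE_def Pi_def abs_le_iff Int_absorb1 subset_iff minus_le_iff)
qed

lemma spectrum_topology_eq: "spectrum_topology t = top_of_set (spectrum t)"
  by (simp add: spectrum_topology_def euclidean_product_topology)

lemma spectrum_eval_eq:
  assumes "u \<in> star_homs t"
  shows "spectrum_eval t f u = u f"
  using assms by (auto simp: spectrum_eval_def spectrum_eq)

text \<open>A set where \<open>\<bar>u f\<bar> \<ge> e > 0\<close> avoids the zero functional, so within the spectrum it is the same
  closed subset as within the compact set \<open>star_homs t\<close>.\<close>

lemma spectrum_eval_in_C0:
  assumes "strong_truncation t"
  shows "spectrum_eval t f \<in> C0 (spectrum_topology t)"
  unfolding C0_def
proof (intro CollectI conjI allI impI)
  have "continuous_on (spectrum t) (\<lambda>u. u f)"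
    by (rule continuous_on_subset[OF continuous_on_product_coordinates]) simp
  then have "continuous_on (spectrum t) (spectrum_eval t f)"
    by (rule continuous_on_eq) (simp add: spectrum_eval_def)
  then show "continuous_map (spectrum_topology t) euclideanreal (spectrum_eval t f)"
    by (simp add: spectrum_topology_eq)
next
  fix e :: real assume e: "e > 0"
  have eq: "{u \<in> topspace (spectrum_topology t). e \<le> \<bar>spectrum_eval t f u\<bar>} = star_homs t \<inter> {u. e \<le> \<bar>u f\<bar>}"
    using e by (auto simp: spectrum_eval_def spectrum_eq)
  have "closed {u. e \<le> \<bar>u f\<bar>}"
    by (intro closed_Collect_le continuous_intros continuous_on_product_coordinates)
  then have "compact (star_homs t \<inter> {u. e \<le> \<bar>u f\<bar>})"
    by (intro compact_Int_closed compact_star_homs assms)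
  moreover have "star_homs t \<inter> {u. e \<le> \<bar>u f\<bar>} \<subseteq> spectrum t"
    using e by (auto simp: spectrum_eq)
  ultimately show "compactin (spectrum_topology t) {u \<in> topspace (spectrum_topology t). e \<le> \<bar>spectrum_eval t f u\<bar>}"
    unfolding eq by (simp add: spectrum_topology_eq compactin_subtopology)
next
  show "spectrum_eval t f u = 0" if "u \<notin> topspace (spectrum_topology t)" for u
    using that by (simp add: spectrum_eval_def)
qed

lemma star_hom_spectrum_eval: "star_hom t (inf 1) (spectrum_eval t)"
proof -
  note D = star_homsD[OF subsetD[OF spectrum_subset_star_homs]]
  have "linear (spectrum_eval t)"
    by (rule linearI) (auto simp: fun_eq_iff spectrum_eval_def scaleR_fun_def D)
  then show ?thesis
    by (auto simp: star_hom_def riesz_hom_def fun_eq_iff spectrum_eval_def D sup_max inf_min)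
qed

text \<open>Members of \<open>C0\<close> are \<open>0\<close> off the spectrum, in particular at the zero functional. Continuity at that
  point is the vanishing at infinity: a set where \<open>\<bar>h\<bar> \<ge> e\<close> is compact, hence closed, so its
  complement is a neighbourhood of the zero functional. At the other points it is enough that the
  spectrum is open in \<open>star_homs t\<close>.\<close>

lemma C0_spectrum_continuous_on_star_homs:
  fixes t :: "'a::riesz_space \<Rightarrow> 'a"
  assumes "h \<in> C0 (spectrum_topology t)"
  shows "continuous_on (star_homs t) h"
proof -
  have cont: "continuous_on (spectrum t) h"
    and cpt: "\<And>e. e > 0 \<Longrightarrow> compact {u \<in> spectrum t. e \<le> \<bar>h u\<bar>}"
    and off: "\<And>u. u \<notin> spectrum t \<Longrightarrow> h u = 0"
    using assms by (auto simp: C0_def spectrum_topology_eq compactin_subtopology)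
  have haus: "Hausdorff_space (euclidean :: ('a \<Rightarrow> real) topology)"
    using Hausdorff_space_product_topology[of "\<lambda>_. euclideanreal" "UNIV :: 'a set"]
    by (simp add: euclidean_product_topology)
  have compact_closed: "closed K" if "compact K" for K :: "('a \<Rightarrow> real) set"
    using compactin_imp_closedin[OF haus, of K] that by simp
  have op: "open (- {\<lambda>f::'a. 0::real})"
    using compact_closed[of "{\<lambda>f. 0}"] by (simp add: open_Compl)
  show ?thesis
    unfolding continuous_on_def
  proof
    fix u assume u: "u \<in> star_homs t"
    show "(h \<longlongrightarrow> h u) (at u within star_homs t)"
    proof (cases "u = (\<lambda>f. 0)")
      case False
      have "at u within star_homs t = at u within spectrum t"
        by (rule at_within_nhd[of _ "- {\<lambda>f. 0}"]) (use False op in \<open>auto simp: spectrum_eq\<close>)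
      moreover have "(h \<longlongrightarrow> h u) (at u within spectrum t)"
        using cont u False by (auto simp: continuous_on_def spectrum_eq)
      ultimately show ?thesis by simp
    next
      case True
      have "h u = 0"
        using True by (intro off) (simp add: spectrum_eq)
      moreover have "(h \<longlongrightarrow> 0) (at u within star_homs t)"
      proof (rule tendstoI)
        fix e :: real assume e: "e > 0"
        have "open (- {v \<in> spectrum t. e \<le> \<bar>h v\<bar>})"
          using compact_closed[OF cpt[OF e]] by (simp add: open_Compl)
        moreover have "u \<in> - {v \<in> spectrum t. e \<le> \<bar>h v\<bar>}"
          using True by (simp add: spectrum_eq)
        moreover have "dist (h v) 0 < e" if "v \<in> - {v \<in> spectrum t. e \<le> \<bar>h v\<bar>}" for v
          using that off[of v] e by (cases "v \<in> spectrum t") auto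
        ultimately show "\<forall>\<^sub>F v in at u within star_homs t. dist (h v) 0 < e"
          unfolding eventually_at_topological by blast
      qed
      ultimately show ?thesis by simp
    qed
  qed
qed

lemma star_homs_truncation_saturates:
  assumes "u \<in> star_homs t" "0 \<le> f" "0 < u f"
  shows "\<exists>n::nat. \<forall>m\<ge>n. u (t (real m *\<^sub>R f)) = 1"
proof -
  obtain n :: nat where n: "1 / u f < real n"
    using reals_Archimedean2 by blast
  have "u (t (real m *\<^sub>R f)) = 1" if "n \<le> m" for m
  proof -
    have "1 / u f \<le> real m" using n that by linarith
    then have "1 \<le> real m * u f"
      using assms(3) by (simp add: pos_divide_le_eq)
    then show ?thesis
      using star_homsD(8)[OF assms(1), of "real m *\<^sub>R f"] star_homsD(2)[OF assms(1)]
        assms(2) by (simp add: scaleR_nonneg_nonneg)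
  qed
  then show ?thesis by blast
qed

text \<open>If the kernel of \<open>u\<close> is contained in that of \<open>v\<close>, then \<open>v\<close> is a multiple of \<open>u\<close>. Truncating
  a large multiple of a positive element gives some \<open>d\<close> with \<open>u d = v d = 1\<close>, so the factor is \<open>1\<close>.\<close>

lemma spectrum_independent:
  assumes u: "u \<in> spectrum t" and v: "v \<in> spectrum t" and "u \<noteq> v"
  shows "\<exists>a. u a = 0 \<and> v a \<noteq> 0"
proof (rule ccontr)
  assume "\<not> ?thesis"
  then have ker: "v a = 0" if "u a = 0" for a
    using that by blast
  note U = star_homsD[OF subsetD[OF spectrum_subset_star_homs u]]
  note V = star_homsD[OF subsetD[OF spectrum_subset_star_homs v]]
  obtain b where b: "v b \<noteq> 0"
    using v by (auto simp: spectrum_eq fun_eq_iff)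
  have b0: "0 < v (riesz_abs b)" "0 < u (riesz_abs b)"
    using b ker[of b] star_homs_riesz_abs[OF subsetD[OF spectrum_subset_star_homs u], of b]
      star_homs_riesz_abs[OF subsetD[OF spectrum_subset_star_homs v], of b] by auto
  obtain k n :: nat where
    "\<forall>m\<ge>k. u (t (real m *\<^sub>R riesz_abs b)) = 1" "\<forall>m\<ge>n. v (t (real m *\<^sub>R riesz_abs b)) = 1"
    using star_homs_truncation_saturates[OF subsetD[OF spectrum_subset_star_homs u] riesz_abs_nonneg b0(2)]
      star_homs_truncation_saturates[OF subsetD[OF spectrum_subset_star_homs v] riesz_abs_nonneg b0(1)]
    by blast
  then obtain d where d: "u d = 1" "v d = 1"
    by (meson max.cobounded1 max.cobounded2)
  have "v f = u f" for f
  proof -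
    have "u (f - u f *\<^sub>R d) = 0"
      using d(1) by (simp add: U(2,3))
    then have "v (f - u f *\<^sub>R d) = 0" by (rule ker)
    then show ?thesis using d(2) by (simp add: V(2,3))
  qed
  with assms(3) show False by auto
qed

text \<open>For distinct points, the value at one of them can be prescribed while the other annihilates:
  for points of the spectrum by independence, and the zero functional imposes no condition beyond
  \<open>h (\<lambda>f. 0) = 0\<close>. Two such elements are added.\<close>

lemma star_homs_interpolate:
  assumes u: "u \<in> star_homs t" and v: "v \<in> star_homs t"
    and h: "h (\<lambda>f. 0) = (0::real)"
  shows "\<exists>f. u f = h u \<and> v f = h v"
proof -
  note U = star_homsD[OF u] note V = star_homsD[OF v]
  have kill: "\<exists>a. w a = h w \<and> w' a = 0"
    if w: "w \<in> star_homs t" "w' \<in> star_homs t" "w \<noteq> w'" for w w'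
  proof (cases "w = (\<lambda>f. 0)")
    case True
    then show ?thesis
      using h star_homsD(5)[OF w(2)] by (intro exI[of _ 0]) auto
  next
    case False
    have "\<exists>a. w' a = 0 \<and> w a \<noteq> 0"
    proof (cases "w' = (\<lambda>f. 0)")
      case True
      with False show ?thesis by (auto simp: fun_eq_iff)
    next
      case w': False
      show ?thesis
        by (rule spectrum_independent) (use w w' False in \<open>auto simp: spectrum_eq\<close>)
    qed
    then obtain a where "w' a = 0" "w a \<noteq> 0" by blast
    then show ?thesis
      using star_homsD(2)[OF w(1)] star_homsD(2)[OF w(2)]
      by (intro exI[of _ "(h w / w a) *\<^sub>R a"]) simp
  qed
  show ?thesis
  proof (cases "u = v")
    case False
    obtain a where a: "u a = h u" "v a = 0" using kill[OF u v False] by blast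
    obtain b where b: "v b = h v" "u b = 0" using kill[OF v u] False by blast
    show ?thesis
      using a b by (intro exI[of _ "a + b"]) (simp add: U(1) V(1))
  next
    case True
    show ?thesis
    proof (cases "u = (\<lambda>f. 0)")
      case True
      with \<open>u = v\<close> h show ?thesis by auto
    next
      case False
      then obtain a where "u a = h u"
        using kill[OF u zero_in_star_homs] by blast
      with True show ?thesis by auto
    qed
  qed
qed

text \<open>The uniform norm is a supremum over all functionals, but off the spectrum both \<open>h\<close> and the
  evaluations vanish, so the approximation on \<open>star_homs t\<close> suffices. Half of \<open>e\<close> is used because a
  supremum of values below a bound need not stay below it.\<close>

lemma uniformly_dense_range_spectrum_eval:
  assumes "strong_truncation t"
  shows "uniformly_dense (range (spectrum_eval t)) (C0 (spectrum_topology t))"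
  unfolding uniformly_dense_def
proof (intro conjI ballI allI impI)
  show "range (spectrum_eval t) \<subseteq> C0 (spectrum_topology t)"
    using spectrum_eval_in_C0[OF assms] by blast
  fix h and e :: real
  assume h: "h \<in> C0 (spectrum_topology t)" and e: "e > 0"
  have off: "h u = 0" if "u \<notin> spectrum t" for u
    using h that by (simp add: C0_def)
  have hom: "riesz_hom (spectrum_eval t)"
    using star_hom_spectrum_eval[of t] by (simp add: star_hom_def)
  have "\<exists>g\<in>range (spectrum_eval t). \<forall>u\<in>star_homs t. \<bar>h u - g u\<bar> < e/2"
  proof (rule lattice_Stone_Weierstrass[OF compact_star_homs[OF assms]])
    show "star_homs t \<noteq> {}" using zero_in_star_homs by blast
    show "continuous_on (star_homs t) g" if "g \<in> range (spectrum_eval t)" for g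
      using that spectrum_eval_in_C0[OF assms] C0_spectrum_continuous_on_star_homs by blast
    show "continuous_on (star_homs t) h"
      by (rule C0_spectrum_continuous_on_star_homs[OF h])
    show "inf f g \<in> range (spectrum_eval t)"
      if fg: "f \<in> range (spectrum_eval t)" "g \<in> range (spectrum_eval t)" for f g
    proof -
      obtain a b where "f = spectrum_eval t a" "g = spectrum_eval t b"
        using fg by blast
      then have "inf f g = spectrum_eval t (inf a b)"
        using hom by (simp add: riesz_hom_def)
      then show ?thesis by simp
    qed
    show "sup f g \<in> range (spectrum_eval t)"
      if fg: "f \<in> range (spectrum_eval t)" "g \<in> range (spectrum_eval t)" for f g
    proof -
      obtain a b where "f = spectrum_eval t a" "g = spectrum_eval t b"
        using fg by blast
      then have "sup f g = spectrum_eval t (sup a b)"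
        using hom by (simp add: riesz_hom_def)
      then show ?thesis by simp
    qed
    show "\<exists>f\<in>range (spectrum_eval t). f u = h u \<and> f v = h v"
      if "u \<in> star_homs t" "v \<in> star_homs t" for u v
      using star_homs_interpolate[OF that, of h] off[of "\<lambda>f. 0"]
      by (auto simp: spectrum_eq spectrum_eval_eq that)
  qed (use e in simp)
  then obtain g where g: "g \<in> range (spectrum_eval t)" "\<forall>u\<in>star_homs t. \<bar>h u - g u\<bar> < e/2"
    by blast
  have "\<bar>(h - g) u\<bar> \<le> e/2" for u
  proof (cases "u \<in> spectrum t")
    case True
    then show ?thesis using g(2) by (auto simp: spectrum_eq less_imp_le)
  next
    case False
    then show ?thesis using g(1) off[of u] e by (auto simp: spectrum_eval_def)
  qed
  then have "uniform_norm (h - g) \<le> e/2"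
    unfolding uniform_norm_def by (intro cSUP_least) auto
  with e g(1) show "\<exists>g\<in>range (spectrum_eval t). uniform_norm (h - g) < e"
    by (intro bexI[of _ g]) auto
qed

text \<open>Elements with equal evaluations have a difference whose modulus is annihilated by the whole
  spectrum, whereas a nonzero positive element is not infinitely small and so is detected by some
  point.\<close>

lemma inj_spectrum_eval:
  assumes "strong_truncation t" "\<And>f. infinitely_small t f \<Longrightarrow> f = 0"
  shows "inj (spectrum_eval t)"
proof (rule injI, rule ccontr)
  fix f g assume eq: "spectrum_eval t f = spectrum_eval t g" and "f \<noteq> g"
  let ?d = "riesz_abs (f - g)"
  have "?d \<noteq> 0"
    using \<open>f \<noteq> g\<close> sup_0_eq_0[of "f - g"] by simp
  then have "\<not> infinitely_small t ?d"
    using assms(2)[of ?d] by blast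
  then obtain u where u: "u \<in> spectrum t" "0 < u ?d"
    using spectrum_separates[OF assms(1) riesz_abs_nonneg] by blast
  have u': "u \<in> star_homs t"
    using u(1) spectrum_subset_star_homs by blast
  have "u f = u g"
    using fun_cong[OF eq, of u] by (simp only: spectrum_eval_eq[OF u'])
  then have "u (f - g) = 0"
    by (simp add: star_homsD(3)[OF u'])
  with u(2) show False
    by (simp only: star_homs_riesz_abs[OF u'])
qed

theorem theorem4p2:
  fixes t :: "'a::riesz_space \<Rightarrow> 'a"
  assumes "strong_truncation t"
    and "\<And>f. infinitely_small t f \<Longrightarrow> f = 0"
  shows "range (spectrum_eval t) \<subseteq> C0 (spectrum_topology t) \<and>
    star_hom t (inf 1) (spectrum_eval t) \<and>
    inj (spectrum_eval t) \<and>
    uniformly_dense (range (spectrum_eval t)) (C0 (spectrum_topology t))"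
  using spectrum_eval_in_C0[OF assms(1)] star_hom_spectrum_eval inj_spectrum_eval[OF assms]
    uniformly_dense_range_spectrum_eval[OF assms(1)] by blast

end
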